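(* Let $0<\delta<1$ be fixed and let $(\eta_n)$ be a sequence of positive real numbers with $\eta_n\to 0$ and $n^{1/2}\eta_n\to\infty$ as $n\to\infty$. Let $a_{n,S}^*$, $a_{n,H}^*$, $a_{n,A}^*$ be the half-lengths of the shortest intervals with infimal coverage probability $\delta$ based on the soft-thresholding (LASSO), hard-thresholding, and adaptive LASSO estimators, respectively. Then $$a_{n,S}^*=\eta_n+n^{-1/2}\Phi^{-1}(\delta)+o(n^{-1/2}),$$ $$a_{n,H}^*=\eta_n+n^{-1/2}\Phi^{-1}(\delta)+o(n^{-1/2}),$$ $$a_{n,A}^*=\eta_n+n^{-1/2}\Phi^{-1}(\delta)+o(n^{-1/2}).$$ (The condition $\eta_n\to 0$ is not used in the derivation of these three expansions.) Hence, the three shortest intervals are asymptotically of the same length. They are also longer than the standard interval based on the maximum likelihood estimator by an order of magnitude: the ratio of each of $a_{n,S}^*$, $a_{n,H}^*$, $a_{n,A}^*$ to the half-length $n^{-1/2}\Phi^{-1}((1+\delta)/2)$ of the standard interval is $n^{1/2}\eta_n$, which diverges to infinity.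
   Context: The data $y_1,\dots,y_n$ are i.i.d. $N(\theta,1)$ with $\theta\in\mathbb{R}$ unknown (variance known and equal to $1$); $P_{n,\theta}$ is the distribution of the sample under $\theta$, and $\bar y=n^{-1}\sum_{i=1}^n y_i$ is the maximum likelihood estimator. $\Phi$ is the standard normal cumulative distribution function. Estimators: soft-thresholding (LASSO) $\hat\theta_S=\operatorname{sign}(\bar y)(|\bar y|-\eta_n)_+$ with $z_+=\max\{z,0\}$ and $\operatorname{sign}(x)=-1,0,1$ according as $x<0$, $x=0$, $x>0$; hard-thresholding $\hat\theta_H=\bar y\,\mathbf{1}(|\bar y|>\eta_n)$; adaptive LASSO $\hat\theta_A=0$ if $|\bar y|\le\eta_n$ and $\hat\theta_A=\bar y-\eta_n^2/\bar y$ if $|\bar y|>\eta_n$. For $\hat\theta$ any of these estimators, the infimal coverage probability of $[\hat\theta-a_n,\hat\theta+b_n]$ ($a_n,b_n\geq0$) is $\inf_{\theta\in\mathbb{R}}P_{n,\theta}(\theta\in[\hat\theta-a_n,\hat\theta+b_n])$. For each of the three estimators the shortest interval of this form with infimal coverage probability not less than $\delta$ exists, is unique, is symmetric ($a_n=b_n$), and has infimal coverage probability exactly $\delta$; its half-length is the unique solution $a\ge 0$ of: $\Phi(n^{1/2}(a-\eta_n))-\Phi(n^{1/2}(-a-\eta_n))=\delta$ for $a=a_{n,S}^*$; $\Phi(n^{1/2}(a-\eta_n))-\Phi(-n^{1/2}a)=\delta$ for $a=a_{n,H}^*$; $\Phi(n^{1/2}(a-\eta_n))-\Phi(-n^{1/2}\sqrt{a^2+\eta_n^2})=\delta$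 for $a=a_{n,A}^*$. The standard interval is $[\bar y-n^{-1/2}\Phi^{-1}((1+\delta)/2),\ \bar y+n^{-1/2}\Phi^{-1}((1+\delta)/2)]$.
   Formalization: The ratio to the standard half-length is stated as asymptotically equivalent to n^{1/2}η_n/Φ^{-1}((1+δ)/2), because the printed "is n^{1/2}η_n" holds only up to this constant factor and asymptotically. *)

theory Defs
  imports "HOL-Probability.Probability" "HOL-Library.Landau_Symbols"
begin

definition sample_dist :: "nat \<Rightarrow> real \<Rightarrow> (nat \<Rightarrow> real) measure" where
  "sample_dist n \<theta> = (\<Pi>\<^sub>M i\<in>{1..n}. density lborel (normal_density \<theta> 1))"

definition sample_mean :: "nat \<Rightarrow> (nat \<Rightarrow> real) \<Rightarrow> real" where
  "sample_mean n y = (\<Sum>i=1..n. y i) / real n"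

definition std_normal_cdf :: "real \<Rightarrow> real" where
  "std_normal_cdf = cdf std_normal_distribution"

(* Only meaningful at arguments strictly between 0 and 1, the range of the cdf. *)
definition std_normal_quantile :: "real \<Rightarrow> real" where
  "std_normal_quantile = inv std_normal_cdf"

definition soft_threshold :: "nat \<Rightarrow> real \<Rightarrow> (nat \<Rightarrow> real) \<Rightarrow> real" where
  "soft_threshold n \<eta> y = sgn (sample_mean n y) * max (\<bar>sample_mean n y\<bar> - \<eta>) 0"

definition hard_threshold :: "nat \<Rightarrow> real \<Rightarrow> (nat \<Rightarrow> real) \<Rightarrow> real" where
  "hard_threshold n \<eta> y = sample_mean n y * of_bool (\<bar>sample_mean n y\<bar> > \<eta>)"

definition adaptive_lasso :: "nat \<Rightarrow> real \<Rightarrow> (nat \<Rightarrow> real) \<Rightarrow> real" where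
  "adaptive_lasso n \<eta> y =
     (if \<bar>sample_mean n y\<bar> \<le> \<eta> then 0
      else sample_mean n y - \<eta>\<^sup>2 / sample_mean n y)"

definition infimal_coverage ::
    "nat \<Rightarrow> ((nat \<Rightarrow> real) \<Rightarrow> real) \<Rightarrow> real \<Rightarrow> real \<Rightarrow> real" where
  "infimal_coverage n est a b =
     (INF \<theta>. measure (sample_dist n \<theta>)
        {y \<in> space (sample_dist n \<theta>). \<theta> \<in> {est y - a .. est y + b}})"

definition is_shortest_interval ::
    "nat \<Rightarrow> ((nat \<Rightarrow> real) \<Rightarrow> real) \<Rightarrow> real \<Rightarrow> real \<Rightarrow> real \<Rightarrow> bool" where
  "is_shortest_interval n est \<delta> a b \<longleftrightarrow>
     0 \<le> a \<and> 0 \<le> b \<and> \<delta> \<le> infimal_coverage n est a b \<and>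
     (\<forall>a' b'. 0 \<le> a' \<and> 0 \<le> b' \<and> \<delta> \<le> infimal_coverage n est a' b' \<longrightarrow> a + b \<le> a' + b')"

(* All shortest intervals have the same length, so the description is unique
   as soon as a shortest interval exists; it is unspecified otherwise. *)
definition shortest_length :: "nat \<Rightarrow> ((nat \<Rightarrow> real) \<Rightarrow> real) \<Rightarrow> real \<Rightarrow> real" where
  "shortest_length n est \<delta> = (THE l. \<exists>a b. is_shortest_interval n est \<delta> a b \<and> l = a + b)"

definition shortest_half_length :: "nat \<Rightarrow> ((nat \<Rightarrow> real) \<Rightarrow> real) \<Rightarrow> real \<Rightarrow> real" where
  "shortest_half_length n est \<delta> = shortest_length n est \<delta> / 2"

definition standard_half_length :: "nat \<Rightarrow> real \<Rightarrow> real" where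
  "standard_half_length n \<delta> = std_normal_quantile ((1 + \<delta>) / 2) / sqrt (real n)"

end

theory Submission
  imports Defs
begin

text \<open>
  The three estimators have the form \<open>g (ybar)\<close>, where \<open>ybar\<close> is the sample mean and the
  function \<open>g\<close> vanishes on \<open>[-\<eta>, \<eta>]\<close>, lies between \<open>0\<close> and the identity, and
  differs from the identity by at most \<open>\<eta>\<close>. These properties, collected in
  \<open>thresholding\<close>, determine the optimal length up to the stated error, so the three
  expansions have one proof.
  Throughout, \<open>q\<close> is the \<open>\<delta>\<close>-quantile of the standard normal distribution function
  \<open>\<Phi>\<close>, and \<open>Z = sqrt n (ybar - \<theta>)\<close>, which is standard normal.

  The interval cannot be short: if \<open>\<theta>\<close> exceeds \<open>b\<close>, it can be covered only when the
  estimate is positive, which requires \<open>ybar > \<eta>\<close> and hence has probability at most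
  \<open>\<Phi> (sqrt n (\<theta> - \<eta>))\<close>. Letting \<open>\<theta>\<close> decrease to \<open>b\<close> gives
  \<open>b \<ge> \<eta> + q / sqrt n\<close>, and negative \<open>\<theta>\<close> give the same bound for \<open>a\<close>
  (\<open>thresholding_feasible_lower\<close>).

  It need not be much longer: let \<open>a = b = \<eta> + c / sqrt n\<close> and \<open>\<theta> \<ge> 0\<close>. Since
  \<open>ybar - \<eta> \<le> g (ybar) \<le> max ybar 0\<close>, the parameter is covered whenever
  \<open>-c \<le> Z \<le> sqrt n \<eta> + c\<close>. The upper limit tends to infinity, so for every
  \<open>c > q\<close> the coverage is eventually at least \<open>\<delta>\<close>, uniformly in \<open>\<theta>\<close>
  (\<open>thresholding_symmetric_feasible\<close>).

  Together these bounds say that \<open>sqrt n (a* - \<eta>)\<close> tends to \<open>q\<close> for the optimal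
  half-length \<open>a*\<close>, provided that a shortest interval exists. It does, because the set of
  pairs \<open>(a, b)\<close> with sufficient coverage is closed (\<open>ex_shortest_interval\<close>). The
  statements about ratios follow since \<open>sqrt n \<eta>\<close> dominates the bounded quantity
  \<open>sqrt n (a* - \<eta>)\<close>.
\<close>

section \<open>The standard normal distribution function and its inverse\<close>

interpretation std_normal: real_distribution std_normal_distribution
  by (rule real_dist_normal_dist)

lemma std_normal_cdf_eq: "std_normal_cdf x = measure std_normal_distribution {..x}"
  by (simp add: std_normal_cdf_def cdf_def)

lemma std_normal_measure_singleton: "measure std_normal_distribution {x} = 0"
proof -
  have "absolutely_continuous lborel std_normal_distribution"
    by (rule absolutely_continuousI_density) simp
  then have "{x} \<in> null_sets std_normal_distribution"
    unfolding absolutely_continuous_def by (rule subsetD) (simp add: null_sets_def)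
  then show ?thesis by (simp add: measure_def null_setsD1)
qed

lemma isCont_std_normal_cdf: "isCont std_normal_cdf x"
  unfolding std_normal_cdf_def std_normal.isCont_cdf by (rule std_normal_measure_singleton)

lemma std_normal_measure_Ioc_pos:
  assumes "x < y"
  shows "0 < measure std_normal_distribution {x<..y}"
proof (rule ccontr)
  assume "\<not> ?thesis"
  then have "measure std_normal_distribution {x<..y} = 0"
    by (simp add: order.antisym not_less)
  then have "emeasure std_normal_distribution {x<..y} = 0"
    by (simp add: std_normal.emeasure_eq_measure)
  then have "AE z in lborel. std_normal_density z * indicator {x<..y} z = 0"
    by (subst (asm) emeasure_density)
       (auto simp: nn_integral_0_iff_AE indicator_def normal_density_def)
  then have "AE z in lborel. z \<notin> {x<..y}"
    by eventually_elim (auto simp: indicator_def normal_density_def split: if_splits)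
  then have "emeasure lborel {x<..y} = 0"
    by (subst (asm) AE_iff_measurable[OF _ refl]) (auto simp: greaterThanAtMost_def greaterThan_def atMost_def Int_def)
  then show False using assms by simp
qed

lemma std_normal_cdf_strict_mono: "strict_mono std_normal_cdf"
proof (rule strict_monoI)
  fix x y :: real assume "x < y"
  then show "std_normal_cdf x < std_normal_cdf y"
    using std_normal.cdf_diff_eq[of x y] std_normal_measure_Ioc_pos[of x y]
    by (simp add: std_normal_cdf_def)
qed

lemma std_normal_cdf_at_top: "(std_normal_cdf \<longlongrightarrow> 1) at_top"
  unfolding std_normal_cdf_def by (rule std_normal.cdf_lim_at_top_prob)

lemma std_normal_measure_atLeast: "measure std_normal_distribution {x..} = std_normal_cdf (- x)"
proof -
  have "distributed std_normal_distribution lborel (\<lambda>z. z) std_normal_density"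
    unfolding distributed_def by (auto intro!: measure_eqI simp: emeasure_distr)
  then have "distributed std_normal_distribution lborel (\<lambda>z. 0 + (-1) * z) (normal_density (0 + (-1) * 0) (\<bar>-1\<bar> * 1))"
    by (rule std_normal.normal_density_affine) auto
  then have D: "distr std_normal_distribution lborel uminus = std_normal_distribution"
    by (simp add: distributed_def)
  have "measure std_normal_distribution {..-x} = measure (distr std_normal_distribution lborel uminus) {..-x}"
    by (simp add: D)
  also have "\<dots> = measure std_normal_distribution {x..}"
    by (subst measure_distr) (auto intro!: arg_cong[where f = "measure _"])
  finally show ?thesis by (simp add: std_normal_cdf_eq)
qed

lemma std_normal_cdf_minus: "std_normal_cdf (- x) = 1 - std_normal_cdf x"
proof -
  have "measure std_normal_distribution {x..} = 1 - measure std_normal_distribution {..<x}"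
    using std_normal.prob_compl[of "{..<x}"] by (simp add: Compl_eq_Diff_UNIV[symmetric])
  also have "measure std_normal_distribution {..<x} = std_normal_cdf x"
  proof -
    have "measure std_normal_distribution ({..<x} \<union> {x})
        = measure std_normal_distribution {..<x} + measure std_normal_distribution {x}"
      by (rule std_normal.finite_measure_Union) auto
    then show ?thesis
      by (simp add: std_normal_measure_singleton ivl_disj_un(2) std_normal_cdf_eq del: Un_insert_right)
  qed
  finally show ?thesis by (simp add: std_normal_measure_atLeast)
qed

lemma std_normal_cdf_quantile:
  assumes "0 < p" "p < 1"
  shows "std_normal_cdf (std_normal_quantile p) = p"
proof -
  have "\<forall>\<^sub>F x in at_top. p < std_normal_cdf x"
    using assms by (intro order_tendstoD(1)[OF std_normal_cdf_at_top])
  then obtain y where y: "p < std_normal_cdf y"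
    by (auto simp: eventually_at_top_linorder)
  have "\<forall>\<^sub>F x in at_top. 1 - p < std_normal_cdf x"
    using assms by (intro order_tendstoD(1)[OF std_normal_cdf_at_top]) simp
  then obtain x where x: "1 - p < std_normal_cdf x"
    by (auto simp: eventually_at_top_linorder)
  have xy: "std_normal_cdf (- x) < std_normal_cdf y"
    using x y by (simp add: std_normal_cdf_minus)
  then have "- x \<le> y"
    using std_normal_cdf_strict_mono by (simp add: strict_mono_less)
  then have "\<exists>z. - x \<le> z \<and> z \<le> y \<and> std_normal_cdf z = p"
    using x y by (intro IVT) (auto simp: std_normal_cdf_minus isCont_std_normal_cdf)
  then show ?thesis
    unfolding std_normal_quantile_def by (metis f_inv_into_f rangeI)
qed

lemma le_std_normal_cdf_iff:
  assumes "0 < p" "p < 1"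
  shows "p \<le> std_normal_cdf x \<longleftrightarrow> std_normal_quantile p \<le> x"
  using std_normal_cdf_quantile[OF assms] std_normal_cdf_strict_mono
  by (metis strict_mono_less_eq)

lemma std_normal_quantile_pos:
  assumes "1/2 < p" "p < 1"
  shows "0 < std_normal_quantile p"
proof -
  have "std_normal_cdf 0 = 1/2"
    using std_normal_cdf_minus[of 0] by simp
  then show ?thesis
    using le_std_normal_cdf_iff[of p 0] assms by auto
qed

section \<open>Estimators that are functions of the sample mean\<close>

text \<open>
  Standardising the sample mean turns coverage under every \<open>\<theta>\<close> into a probability under
  one and the same distribution.
\<close>

lemma distr_sample_mean:
  assumes n: "n \<ge> 1"
  shows "distr (sample_dist n \<theta>) borel (\<lambda>y. sqrt (real n) * (sample_mean n y - \<theta>))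
           = std_normal_distribution"
proof -
  let ?N = "density lborel (normal_density \<theta> 1)"
  let ?P = "sample_dist n \<theta>"
  let ?I = "{1..n}"
  interpret N: prob_space ?N by (rule prob_space_normal_density) simp
  interpret P: prob_space ?P
    unfolding sample_dist_def by (rule prob_space_PiM) (rule N.prob_space_axioms)
  have ne: "?I \<noteq> {}" using n by auto
  have meas: "(\<lambda>y. y i) \<in> borel_measurable ?P" if "i \<in> ?I" for i
    using measurable_component_singleton[OF that, of "\<lambda>_. ?N"]
    by (simp add: sample_dist_def cong: measurable_cong_sets)
  have coord: "distr ?P borel (\<lambda>y. y i) = ?N" if "i \<in> ?I" for i
  proof -
    have "distr ?P borel (\<lambda>y. y i) = distr ?P ?N (\<lambda>y. y i)"
      by (rule distr_cong) auto
    also have "\<dots> = ?N"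
      unfolding sample_dist_def by (rule distr_PiM_component[OF _ that]) (rule N.prob_space_axioms)
    finally show ?thesis .
  qed
  have indep: "P.indep_vars (\<lambda>i. borel) (\<lambda>i y. y i) ?I"
  proof (subst P.indep_vars_iff_distr_eq_PiM'[OF ne meas])
    have "distr ?P (Pi\<^sub>M ?I (\<lambda>i. borel)) (\<lambda>y. \<lambda>i\<in>?I. y i) = distr ?P ?P (\<lambda>y. y)"
      by (rule distr_cong)
         (auto simp: sample_dist_def space_PiM intro!: sets_PiM_cong restrict_ext)
    also have "\<dots> = ?P" by (rule distr_id2) simp
    also have "\<dots> = Pi\<^sub>M ?I (\<lambda>i. distr ?P borel (\<lambda>y. y i))"
      unfolding sample_dist_def
      by (rule PiM_cong) (use coord in \<open>auto simp: sample_dist_def\<close>)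
    finally show "distr ?P (Pi\<^sub>M ?I (\<lambda>i. borel)) (\<lambda>y. \<lambda>i\<in>?I. y i)
        = Pi\<^sub>M ?I (\<lambda>i. distr ?P borel (\<lambda>y. y i))" .
  qed auto
  have normal: "distributed ?P lborel (\<lambda>y. y i) (normal_density \<theta> 1)" if "i \<in> ?I" for i
    unfolding distributed_def using coord[OF that] meas[OF that]
    by (auto cong: distr_cong)
  have "distributed ?P lborel (\<lambda>y. \<Sum>i\<in>?I. y i)
      (normal_density (\<Sum>i\<in>?I. \<theta>) (sqrt (\<Sum>i\<in>?I. 1\<^sup>2)))"
    by (rule P.sum_indep_normal[OF _ ne indep _ normal]) auto
  then have "distributed ?P lborel (\<lambda>y. \<Sum>i\<in>?I. y i) (normal_density (real n * \<theta>) (sqrt (real n)))"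
    by simp
  then have "distributed ?P lborel (\<lambda>y. ((\<Sum>i\<in>?I. y i) - real n * \<theta>) / sqrt (real n)) std_normal_density"
    using n by (subst (asm) P.normal_standard_normal_convert) auto
  moreover have "((\<Sum>i\<in>?I. y i) - real n * \<theta>) / sqrt (real n)
      = sqrt (real n) * (sample_mean n y - \<theta>)" for y
    using n by (simp add: sample_mean_def field_simps flip: power2_eq_square)
  ultimately have "distr ?P lborel (\<lambda>y. sqrt (real n) * (sample_mean n y - \<theta>)) = std_normal_distribution"
    by (simp add: distributed_def)
  then show ?thesis by (metis distr_cong sets_lborel)
qed

lemma measurable_sample_mean: "sample_mean n \<in> borel_measurable (sample_dist n \<theta>)"
proof -
  have "(\<lambda>y. y i) \<in> borel_measurable (sample_dist n \<theta>)" if "i \<in> {1..n}" for i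
    using measurable_component_singleton[OF that, of "\<lambda>_. density lborel (normal_density \<theta> 1)"]
    by (simp add: sample_dist_def cong: measurable_cong_sets)
  then show ?thesis
    unfolding sample_mean_def[abs_def] by (intro borel_measurable_divide borel_measurable_sum) auto
qed

lemma coverage_eq:
  assumes n: "n \<ge> 1" and g [measurable]: "g \<in> borel_measurable borel"
  shows "measure (sample_dist n \<theta>) {y \<in> space (sample_dist n \<theta>).
             \<theta> \<in> {g (sample_mean n y) - a .. g (sample_mean n y) + b}}
         = measure std_normal_distribution
             {z. \<theta> - b \<le> g (\<theta> + z / sqrt (real n)) \<and> g (\<theta> + z / sqrt (real n)) \<le> \<theta> + a}"
    (is "?L = measure _ ?A")
proof -
  note [measurable] = measurable_sample_mean
  have "?A \<in> sets borel" by measurable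
  then have "measure (distr (sample_dist n \<theta>) borel (\<lambda>y. sqrt (real n) * (sample_mean n y - \<theta>))) ?A = ?L"
    using n by (subst measure_distr) (auto intro!: arg_cong[where f = "measure _"])
  then show ?thesis using n by (simp add: distr_sample_mean)
qed

lemma le_infimal_coverage_iff:
  "\<delta> \<le> infimal_coverage n est a b \<longleftrightarrow>
     (\<forall>\<theta>. \<delta> \<le> measure (sample_dist n \<theta>)
        {y \<in> space (sample_dist n \<theta>). \<theta> \<in> {est y - a .. est y + b}})"
  unfolding infimal_coverage_def
  by (subst le_cINF_iff) (auto intro!: bdd_belowI[of _ 0])

section \<open>Existence of shortest intervals\<close>

text \<open>
  The covering event is closed, so coverage is upper semicontinuous in the margins: enlarging the
  limit margins by \<open>1 / (m + 1)\<close> gives an interval that contains nearby intervals of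
  coverage at least \<open>\<delta>\<close>, and continuity from above removes the enlargement.
\<close>

lemma (in finite_measure) closed_interval_coverage:
  fixes X :: "'a \<Rightarrow> real"
  assumes [measurable]: "X \<in> borel_measurable M"
  shows "closed {p. \<delta> \<le> measure M {x \<in> space M. c \<in> {X x - fst p .. X x + snd p}}}"
  unfolding closed_sequential_limits
proof (intro allI impI, elim conjE)
  fix p :: "nat \<Rightarrow> real \<times> real" and l
  assume mem: "\<forall>k. p k \<in> {p. \<delta> \<le> measure M {x \<in> space M. c \<in> {X x - fst p .. X x + snd p}}}"
    and lim: "p \<longlonglongrightarrow> l"
  define A where "A m = {x \<in> space M. c \<in> {X x - (fst l + 1 / real (Suc m)) .. X x + (snd l + 1 / real (Suc m))}}" for m
  have A_sets: "range A \<subseteq> sets M"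
    unfolding A_def by auto
  have "decseq A"
  proof (rule decseq_SucI)
    fix m
    have "1 / real (Suc (Suc m)) \<le> 1 / real (Suc m)" by (simp add: frac_le)
    then show "A (Suc m) \<subseteq> A m" unfolding A_def by auto
  qed
  then have "(\<lambda>m. measure M (A m)) \<longlonglongrightarrow> measure M (\<Inter>m. A m)"
    using A_sets by (intro finite_Lim_measure_decseq)
  moreover have "\<delta> \<le> measure M (A m)" for m
  proof -
    have "\<forall>\<^sub>F k in sequentially. fst (p k) < fst l + 1 / real (Suc m)"
      using tendsto_fst[OF lim] by (rule order_tendstoD) simp
    moreover have "\<forall>\<^sub>F k in sequentially. snd (p k) < snd l + 1 / real (Suc m)"
      using tendsto_snd[OF lim] by (rule order_tendstoD) simp
    ultimately have "\<forall>\<^sub>F k in sequentially. fst (p k) < fst l + 1 / real (Suc m) \<and> snd (p k) < snd l + 1 / real (Suc m)"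
      by eventually_elim simp
    then obtain k where "fst (p k) < fst l + 1 / real (Suc m)" "snd (p k) < snd l + 1 / real (Suc m)"
      by (auto simp: eventually_sequentially)
    then have "{x \<in> space M. c \<in> {X x - fst (p k) .. X x + snd (p k)}} \<subseteq> A m"
      unfolding A_def by auto
    then have "measure M {x \<in> space M. c \<in> {X x - fst (p k) .. X x + snd (p k)}} \<le> measure M (A m)"
      using A_sets by (intro finite_measure_mono) auto
    then show ?thesis using mem by (auto intro: order_trans)
  qed
  ultimately have "\<delta> \<le> measure M (\<Inter>m. A m)"
    by (intro LIMSEQ_le_const) auto
  moreover have "(\<Inter>m. A m) = {x \<in> space M. c \<in> {X x - fst l .. X x + snd l}}" (is "_ = ?B")
  proof
    show "(\<Inter>m. A m) \<subseteq> ?B"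
    proof
      fix x assume x: "x \<in> (\<Inter>m. A m)"
      have lims: "(\<lambda>m. fst l + 1 / real (Suc m)) \<longlonglongrightarrow> fst l + 0" "(\<lambda>m. snd l + 1 / real (Suc m)) \<longlonglongrightarrow> snd l + 0"
        by (rule tendsto_add[OF tendsto_const LIMSEQ_Suc[OF lim_1_over_n[where 'a = real]]])+
      have "X x - c \<le> fst l + 0"
        by (rule LIMSEQ_le_const[OF lims(1)]) (use x in \<open>auto simp: A_def algebra_simps\<close>)
      moreover have "c - X x \<le> snd l + 0"
        by (rule LIMSEQ_le_const[OF lims(2)]) (use x in \<open>auto simp: A_def algebra_simps\<close>)
      ultimately show "x \<in> ?B" using x by (auto simp: A_def)
    qed
    show "?B \<subseteq> (\<Inter>m. A m)"
    proof (intro INT_greatest)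
      fix m
      define e where "e = 1 / real (Suc m)"
      have "0 \<le> e" by (simp add: e_def)
      then show "?B \<subseteq> A m"
        unfolding A_def e_def[symmetric] by auto
    qed
  qed
  ultimately show "l \<in> {p. \<delta> \<le> measure M {x \<in> space M. c \<in> {X x - fst p .. X x + snd p}}}"
    by simp
qed

text \<open>
  Sufficient infimal coverage is an intersection over \<open>\<theta>\<close> of closed conditions. Once one
  pair is feasible, the search can be restricted to a triangle, which is compact.
\<close>

lemma ex_shortest_interval:
  assumes meas: "\<And>\<theta>. est \<in> borel_measurable (sample_dist n \<theta>)"
    and feasible: "0 \<le> a0" "0 \<le> b0" "\<delta> \<le> infimal_coverage n est a0 b0"
  shows "\<exists>a b. is_shortest_interval n est \<delta> a b"
proof -
  define F where "F = {p. \<delta> \<le> infimal_coverage n est (fst p) (snd p)}"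
  define K where "K = F \<inter> {p. 0 \<le> fst p \<and> 0 \<le> snd p \<and> fst p + snd p \<le> a0 + b0}"
  have "closed F"
  proof -
    have "finite_measure (sample_dist n \<theta>)" for \<theta>
      unfolding sample_dist_def
      by (intro prob_space.finite_measure prob_space_PiM prob_space_normal_density) simp
    from finite_measure.closed_interval_coverage[OF this meas] show ?thesis
      unfolding F_def le_infimal_coverage_iff by (rule closed_Collect_all)
  qed
  then have "closed K"
    unfolding K_def by (intro closed_Int closed_Collect_conj closed_Collect_le continuous_intros)
  moreover have "K \<subseteq> cbox (0, 0) (a0 + b0, a0 + b0)"
    by (auto simp: K_def cbox_Pair_eq)
  ultimately have "compact K"
    by (meson bounded_cbox bounded_subset compact_eq_bounded_closed)
  moreover have "(a0, b0) \<in> K"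
    using feasible by (simp add: K_def F_def)
  moreover have "continuous_on K (\<lambda>p. fst p + snd p)"
    by (intro continuous_intros)
  ultimately obtain p where p: "p \<in> K" "\<And>p'. p' \<in> K \<Longrightarrow> fst p + snd p \<le> fst p' + snd p'"
    using continuous_attains_inf[of K "\<lambda>p. fst p + snd p"] by blast
  have "is_shortest_interval n est \<delta> (fst p) (snd p)"
    unfolding is_shortest_interval_def
  proof (intro conjI allI impI)
    fix a b assume ab: "0 \<le> a \<and> 0 \<le> b \<and> \<delta> \<le> infimal_coverage n est a b"
    show "fst p + snd p \<le> a + b"
    proof (cases "a + b \<le> a0 + b0")
      case True
      then show ?thesis using ab p(2)[of "(a, b)"] by (simp add: K_def F_def)
    next
      case False
      then show ?thesis using p(1) by (simp add: K_def)
    qed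
  qed (use p(1) in \<open>auto simp: K_def F_def\<close>)
  then show ?thesis by blast
qed

lemma shortest_half_length_eq:
  assumes "is_shortest_interval n est \<delta> a b"
  shows "shortest_half_length n est \<delta> = (a + b) / 2"
proof -
  have "(THE l. \<exists>a b. is_shortest_interval n est \<delta> a b \<and> l = a + b) = a + b"
  proof (rule the_equality)
    fix l assume "\<exists>a b. is_shortest_interval n est \<delta> a b \<and> l = a + b"
    then show "l = a + b"
      using assms unfolding is_shortest_interval_def by (metis order.antisym)
  qed (use assms in blast)
  then show ?thesis by (simp add: shortest_half_length_def shortest_length_def)
qed

section \<open>Bounds for the shortest length of a thresholding interval\<close>

text \<open>
  The common features of soft-thresholding, hard-thresholding and the adaptive LASSO, as functions
  of the sample mean.
\<close>

definition thresholding :: "real \<Rightarrow> (real \<Rightarrow> real) \<Rightarrow> bool" where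
  "thresholding \<eta> g \<longleftrightarrow> g \<in> borel_measurable borel \<and>
     (\<forall>x. min x 0 \<le> g x \<and> g x \<le> max x 0 \<and> \<bar>g x - x\<bar> \<le> \<eta> \<and> (\<bar>x\<bar> \<le> \<eta> \<longrightarrow> g x = 0))"

lemma thresholdingD:
  assumes "thresholding \<eta> g"
  shows "g \<in> borel_measurable borel"
    and "min x 0 \<le> g x" "g x \<le> max x 0" "x - \<eta> \<le> g x" "g x \<le> x + \<eta>"
    and "\<bar>x\<bar> \<le> \<eta> \<Longrightarrow> g x = 0"
  using assms unfolding thresholding_def by (auto simp: abs_le_iff algebra_simps)

lemma thresholding_soft:
  assumes "0 < \<eta>"
  shows "thresholding \<eta> (\<lambda>x. sgn x * max (\<bar>x\<bar> - \<eta>) 0)"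
  using assms unfolding thresholding_def by (auto simp: sgn_if max_def min_def abs_if)

lemma thresholding_hard:
  assumes "0 < \<eta>"
  shows "thresholding \<eta> (\<lambda>x. x * of_bool (\<bar>x\<bar> > \<eta>))"
  using assms unfolding thresholding_def of_bool_def by (auto simp: max_def min_def)

lemma thresholding_adaptive:
  assumes "0 < \<eta>"
  shows "thresholding \<eta> (\<lambda>x. if \<bar>x\<bar> \<le> \<eta> then 0 else x - \<eta>\<^sup>2 / x)"
proof -
  have pos: "0 \<le> \<eta>\<^sup>2 / x \<and> \<eta>\<^sup>2 / x \<le> \<eta>" if "\<eta> < x" for x
  proof -
    have "\<eta> * \<eta> \<le> \<eta> * x" using that assms by simp
    then show ?thesis using that assms by (simp add: divide_le_eq power2_eq_square)
  qed
  have "min x 0 \<le> x - \<eta>\<^sup>2 / x \<and> x - \<eta>\<^sup>2 / x \<le> max x 0 \<and> \<bar>x - \<eta>\<^sup>2 / x - x\<bar> \<le> \<eta>"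
    if "\<not> \<bar>x\<bar> \<le> \<eta>" for x
  proof (cases "x > 0")
    case True
    then show ?thesis using pos[of x] that by auto
  next
    case False
    then show ?thesis using pos[of "- x"] that by auto
  qed
  then show ?thesis using assms unfolding thresholding_def by simp
qed

text \<open>
  A parameter outside \<open>[-a, b]\<close> is missed whenever the estimator is set to zero, and
  also whenever the estimate has the wrong sign. What remains is a half-line of values of the
  sample mean on one side of the threshold.
\<close>

lemma thresholding_feasible_lower:
  assumes n: "n \<ge> 1" and \<delta>: "0 < \<delta>" "\<delta> < 1" and g: "thresholding \<eta> g"
    and ab: "0 \<le> a" "0 \<le> b" "\<delta> \<le> infimal_coverage n (\<lambda>y. g (sample_mean n y)) a b"
  shows "\<eta> + std_normal_quantile \<delta> / sqrt (real n) \<le> a"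
    and "\<eta> + std_normal_quantile \<delta> / sqrt (real n) \<le> b"
proof -
  let ?s = "sqrt (real n)" and ?q = "std_normal_quantile \<delta>"
  have s: "?s > 0" using n by simp
  note gD = thresholdingD[OF g]
  have cov: "\<delta> \<le> measure std_normal_distribution {z. \<theta> - b \<le> g (\<theta> + z / ?s) \<and> g (\<theta> + z / ?s) \<le> \<theta> + a}" for \<theta>
    using ab(3) coverage_eq[OF n gD(1)] unfolding le_infimal_coverage_iff by simp
  show "\<eta> + ?q / ?s \<le> b"
  proof (rule dense_ge)
    fix \<theta> assume \<theta>: "b < \<theta>"
    have "{z. \<theta> - b \<le> g (\<theta> + z / ?s) \<and> g (\<theta> + z / ?s) \<le> \<theta> + a} \<subseteq> {- (?s * (\<theta> - \<eta>))..}"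
    proof safe
      fix z assume "\<theta> - b \<le> g (\<theta> + z / ?s)"
      then have pos: "0 < g (\<theta> + z / ?s)" using \<theta> by simp
      then have "\<not> \<bar>\<theta> + z / ?s\<bar> \<le> \<eta>" "\<theta> + z / ?s > 0"
        using gD(6)[of "\<theta> + z / ?s"] gD(3)[of "\<theta> + z / ?s"] by auto
      then have "\<eta> < \<theta> + z / ?s" by simp
      then show "- (?s * (\<theta> - \<eta>)) \<le> z" using s by (simp add: field_simps)
    qed
    then have "\<delta> \<le> std_normal_cdf (?s * (\<theta> - \<eta>))"
      using order_trans[OF cov[of \<theta>] std_normal.finite_measure_mono, of "{- (?s * (\<theta> - \<eta>))..}"]
      by (simp add: std_normal_measure_atLeast)
    then have "?q \<le> ?s * (\<theta> - \<eta>)" using \<delta> by (simp add: le_std_normal_cdf_iff)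
    then show "\<eta> + ?q / ?s \<le> \<theta>" using s by (simp add: field_simps)
  qed
  show "\<eta> + ?q / ?s \<le> a"
  proof (rule dense_ge)
    fix t assume t: "a < t"
    define \<theta> where "\<theta> = - t"
    have "{z. \<theta> - b \<le> g (\<theta> + z / ?s) \<and> g (\<theta> + z / ?s) \<le> \<theta> + a} \<subseteq> {..?s * (t - \<eta>)}"
    proof safe
      fix z assume "g (\<theta> + z / ?s) \<le> \<theta> + a"
      then have pos: "g (\<theta> + z / ?s) < 0" using t by (simp add: \<theta>_def)
      then have "\<not> \<bar>\<theta> + z / ?s\<bar> \<le> \<eta>" "\<theta> + z / ?s < 0"
        using gD(6)[of "\<theta> + z / ?s"] gD(2)[of "\<theta> + z / ?s"] by auto
      then have "\<theta> + z / ?s < - \<eta>" by simp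
      then show "z \<le> ?s * (t - \<eta>)" using s by (simp add: \<theta>_def field_simps)
    qed
    then have "\<delta> \<le> std_normal_cdf (?s * (t - \<eta>))"
      using order_trans[OF cov[of \<theta>] std_normal.finite_measure_mono, of "{..?s * (t - \<eta>)}"]
      by (simp add: std_normal_cdf_eq)
    then have "?q \<le> ?s * (t - \<eta>)" using \<delta> by (simp add: le_std_normal_cdf_iff)
    then show "\<eta> + ?q / ?s \<le> t" using s by (simp add: field_simps)
  qed
qed

text \<open>
  For \<open>\<theta> \<ge> 0\<close> the estimator errs downwards by at most the threshold beyond the error of
  the sample mean, which leaves the margin \<open>c\<close> for the latter; upwards it never errs by more
  than the sample mean does, except that it may be zero, so there the margin is all of
  \<open>d\<close>. For negative \<open>\<theta>\<close> the two sides are exchanged.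
\<close>

lemma thresholding_symmetric_feasible:
  assumes n: "n \<ge> 1" and g: "thresholding \<eta> g"
    and d: "d = sqrt (real n) * \<eta> + c" "0 \<le> d"
    and \<delta>: "\<delta> \<le> std_normal_cdf c + std_normal_cdf d - 1"
  shows "\<delta> \<le> infimal_coverage n (\<lambda>y. g (sample_mean n y)) (d / sqrt (real n)) (d / sqrt (real n))"
  unfolding le_infimal_coverage_iff coverage_eq[OF n thresholdingD(1)[OF g]]
proof
  fix \<theta> :: real
  let ?s = "sqrt (real n)"
  let ?A = "{z. \<theta> - d / ?s \<le> g (\<theta> + z / ?s) \<and> g (\<theta> + z / ?s) \<le> \<theta> + d / ?s}"
  have s: "?s > 0" using n by simp
  note gD = thresholdingD[OF g]
  have a: "d / ?s = \<eta> + c / ?s" "0 \<le> d / ?s" using s d by (auto simp: field_simps)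
  note [measurable] = gD(1)
  have A: "?A \<in> sets std_normal_distribution" by measurable
  have Ioc: "std_normal_cdf y - std_normal_cdf x \<le> measure std_normal_distribution {x<..y}" for x y
    using std_normal.cdf_diff_eq[of x y] strict_mono_less_eq[OF std_normal_cdf_strict_mono, of y x]
    by (cases "x < y") (auto simp: std_normal_cdf_def)
  show "\<delta> \<le> measure std_normal_distribution ?A"
  proof (cases "\<theta> \<ge> 0")
    case True
    have "{-c<..d} \<subseteq> ?A"
    proof safe
      fix z assume "z \<in> {-c<..d}"
      then have z: "- (c / ?s) \<le> z / ?s" "z / ?s \<le> d / ?s"
        using s by (auto simp: field_simps)
      show "\<theta> - d / ?s \<le> g (\<theta> + z / ?s)"
        using gD(4)[of "\<theta> + z / ?s"] z a by linarith
      show "g (\<theta> + z / ?s) \<le> \<theta> + d / ?s"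
        using gD(3)[of "\<theta> + z / ?s"] z a True by linarith
    qed
    then have "measure std_normal_distribution {-c<..d} \<le> measure std_normal_distribution ?A"
      using A by (rule std_normal.finite_measure_mono)
    then show ?thesis using \<delta> Ioc[of d "-c"] by (simp add: std_normal_cdf_minus)
  next
    case False
    have "{-d<..c} \<subseteq> ?A"
    proof safe
      fix z assume "z \<in> {-d<..c}"
      then have z: "- (d / ?s) \<le> z / ?s" "z / ?s \<le> c / ?s"
        using s by (auto simp: field_simps)
      show "\<theta> - d / ?s \<le> g (\<theta> + z / ?s)"
        using gD(2)[of "\<theta> + z / ?s"] z a False by linarith
      show "g (\<theta> + z / ?s) \<le> \<theta> + d / ?s"
        using gD(5)[of "\<theta> + z / ?s"] z a by linarith
    qed
    then have "measure std_normal_distribution {-d<..c} \<le> measure std_normal_distribution ?A"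
      using A by (rule std_normal.finite_measure_mono)
    then show ?thesis using \<delta> Ioc[of c "-d"] by (simp add: std_normal_cdf_minus)
  qed
qed

lemma shortest_half_length_bounds:
  assumes n: "n \<ge> 1" and \<delta>: "0 < \<delta>" "\<delta> < 1" and g: "thresholding \<eta> g"
    and d: "d = sqrt (real n) * \<eta> + c" "0 \<le> d"
    and cov: "\<delta> \<le> std_normal_cdf c + std_normal_cdf d - 1"
    and l: "l = shortest_half_length n (\<lambda>y. g (sample_mean n y)) \<delta>"
  shows "std_normal_quantile \<delta> \<le> sqrt (real n) * (l - \<eta>)" "sqrt (real n) * (l - \<eta>) \<le> c"
proof -
  let ?s = "sqrt (real n)" and ?est = "\<lambda>y. g (sample_mean n y)"
  have s: "?s > 0" using n by simp
  have feas: "0 \<le> d / ?s" "\<delta> \<le> infimal_coverage n ?est (d / ?s) (d / ?s)"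
    using d s thresholding_symmetric_feasible[OF n g d cov] by auto
  have "?est \<in> borel_measurable (sample_dist n \<theta>)" for \<theta>
    using measurable_compose[OF measurable_sample_mean thresholdingD(1)[OF g]] .
  from ex_shortest_interval[OF this feas(1) feas]
  obtain a b where ab: "is_shortest_interval n ?est \<delta> a b" by blast
  have l: "l = (a + b) / 2" using shortest_half_length_eq[OF ab] l by simp
  define h where "h = d / ?s"
  have "a + b \<le> h + h"
    using ab feas unfolding is_shortest_interval_def h_def by blast
  then have "l \<le> h" by (simp add: l)
  then have "?s * l \<le> d" using s by (simp add: h_def pos_le_divide_eq mult.commute)
  then show "?s * (l - \<eta>) \<le> c" using d by (simp add: algebra_simps)
  define k where "k = \<eta> + std_normal_quantile \<delta> / ?s"
  have "k \<le> a" "k \<le> b"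
    using ab thresholding_feasible_lower[OF n \<delta> g, of a b]
    unfolding is_shortest_interval_def k_def by auto
  then have "k \<le> l" by (simp add: l)
  then show "std_normal_quantile \<delta> \<le> ?s * (l - \<eta>)" using s by (simp add: k_def field_simps)
qed

section \<open>Asymptotic expansion\<close>

text \<open>
  The lower bound has no error term. For the upper bound any \<open>c\<close> above the quantile
  will do eventually: \<open>\<Phi> c > \<delta>\<close> leaves room for the other tail, which vanishes as the
  scaled threshold diverges.
\<close>

lemma shortest_half_length_limit:
  assumes \<delta>: "0 < \<delta>" "\<delta> < 1"
    and g: "\<And>n. n \<ge> 1 \<Longrightarrow> thresholding (\<eta> n) (g n)"
    and \<eta>: "filterlim (\<lambda>n. sqrt (real n) * \<eta> n) at_top sequentially"
  shows "(\<lambda>n. sqrt (real n) * (shortest_half_length n (\<lambda>y. g n (sample_mean n y)) \<delta> - \<eta> n))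
           \<longlonglongrightarrow> std_normal_quantile \<delta>"
proof (rule order_tendstoI)
  let ?q = "std_normal_quantile \<delta>"
  let ?l = "\<lambda>n. sqrt (real n) * (shortest_half_length n (\<lambda>y. g n (sample_mean n y)) \<delta> - \<eta> n)"
  have bounds: "\<forall>\<^sub>F n in sequentially. ?q \<le> ?l n \<and> ?l n \<le> c" if c: "?q < c" for c
  proof -
    have "\<delta> < std_normal_cdf c"
      using c strict_monoD[OF std_normal_cdf_strict_mono c] std_normal_cdf_quantile[OF \<delta>] by simp
    moreover have d: "filterlim (\<lambda>n. sqrt (real n) * \<eta> n + c) at_top sequentially"
      using filterlim_tendsto_add_at_top[OF tendsto_const \<eta>, of c] by (simp add: add.commute)
    then have "(\<lambda>n. std_normal_cdf (sqrt (real n) * \<eta> n + c)) \<longlonglongrightarrow> 1"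
      by (rule filterlim_compose[OF std_normal_cdf_at_top])
    ultimately have "\<forall>\<^sub>F n in sequentially. 1 - (std_normal_cdf c - \<delta>) < std_normal_cdf (sqrt (real n) * \<eta> n + c)"
      by (intro order_tendstoD) auto
    moreover have "\<forall>\<^sub>F n in sequentially. 0 \<le> sqrt (real n) * \<eta> n + c"
      using d by (simp add: filterlim_at_top)
    moreover have "\<forall>\<^sub>F n in sequentially. n \<ge> (1::nat)"
      by (rule eventually_ge_at_top)
    ultimately show ?thesis
    proof eventually_elim
      case (elim n)
      show ?case
        using shortest_half_length_bounds[OF elim(3) \<delta> g[OF elim(3)] refl elim(2) _ refl] elim(1) by auto
    qed
  qed
  show "\<forall>\<^sub>F n in sequentially. x < ?l n" if "x < ?q" for x
    using bounds[of "?q + 1"] by (auto elim!: eventually_mono intro: less_le_trans[OF that])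
  show "\<forall>\<^sub>F n in sequentially. ?l n < x" if "?q < x" for x
    using bounds[of "(?q + x) / 2"] that by (auto elim!: eventually_mono)
qed

lemma expansion_of_scaled_limit:
  assumes "(\<lambda>n. sqrt (real n) * (a n - \<eta> n)) \<longlonglongrightarrow> q"
  shows "(\<lambda>n. a n - (\<eta> n + q / sqrt (real n))) \<in> o[sequentially](\<lambda>n. 1 / sqrt (real n))"
proof (rule smalloI_tendsto)
  have "(\<lambda>n. sqrt (real n) * (a n - \<eta> n) - q) \<longlonglongrightarrow> 0"
    using tendsto_diff[OF assms tendsto_const[of q]] by simp
  moreover have "\<forall>\<^sub>F n in sequentially. sqrt (real n) * (a n - \<eta> n) - q
      = (a n - (\<eta> n + q / sqrt (real n))) / (1 / sqrt (real n))"
    using eventually_gt_at_top[of "0::nat"] by eventually_elim (simp add: field_simps)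
  ultimately show "(\<lambda>n. (a n - (\<eta> n + q / sqrt (real n))) / (1 / sqrt (real n))) \<longlonglongrightarrow> 0"
    by (rule Lim_transform_eventually)
  show "\<forall>\<^sub>F n in sequentially. 1 / sqrt (real n) \<noteq> 0"
    using eventually_gt_at_top[of "0::nat"] by eventually_elim simp
qed

lemma asymp_equiv_of_scaled_limit:
  assumes a: "(\<lambda>n. sqrt (real n) * (a n - \<eta> n)) \<longlonglongrightarrow> q"
    and \<eta>: "filterlim (\<lambda>n. sqrt (real n) * \<eta> n) at_top sequentially"
  shows "a \<sim>[sequentially] \<eta>"
proof (rule asymp_equivI')
  have "(\<lambda>n. sqrt (real n) * (a n - \<eta> n) / (sqrt (real n) * \<eta> n)) \<longlonglongrightarrow> 0"
    using a filterlim_at_top_imp_at_infinity[OF \<eta>] by (rule tendsto_divide_0)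
  then have "(\<lambda>n. sqrt (real n) * (a n - \<eta> n) / (sqrt (real n) * \<eta> n) + 1) \<longlonglongrightarrow> 0 + 1"
    by (intro tendsto_add tendsto_const)
  moreover have "\<forall>\<^sub>F n in sequentially. sqrt (real n) * \<eta> n > 0"
    using \<eta> by (simp add: filterlim_at_top_dense)
  then have "\<forall>\<^sub>F n in sequentially.
      sqrt (real n) * (a n - \<eta> n) / (sqrt (real n) * \<eta> n) + 1 = a n / \<eta> n"
  proof eventually_elim
    case (elim n)
    then have "sqrt (real n) \<noteq> 0" "\<eta> n \<noteq> 0" by (metis less_irrefl mult_zero_left, auto)
    then show ?case by (simp add: diff_divide_distrib del: real_sqrt_eq_zero_cancel_iff)
  qed
  ultimately show "(\<lambda>n. a n / \<eta> n) \<longlonglongrightarrow> 1"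
    using Lim_transform_eventually by fastforce
qed

theorem mainTheorem5:
  fixes \<delta> :: real and \<eta> :: "nat \<Rightarrow> real" and aS aH aA :: "nat \<Rightarrow> real"
  assumes "0 < \<delta>" and "\<delta> < 1"
    and "\<And>n. n \<ge> 1 \<Longrightarrow> \<eta> n > 0"
    and "filterlim (\<lambda>n. sqrt (real n) * \<eta> n) at_top sequentially"
  defines "aS \<equiv> \<lambda>n. shortest_half_length n (soft_threshold n (\<eta> n)) \<delta>"
    and "aH \<equiv> \<lambda>n. shortest_half_length n (hard_threshold n (\<eta> n)) \<delta>"
    and "aA \<equiv> \<lambda>n. shortest_half_length n (adaptive_lasso n (\<eta> n)) \<delta>"
  shows
    \<comment> \<open>the expansions, for which the convergence of the thresholds to 0 is not needed\<close>
    "((\<forall>a \<in> {aS, aH, aA}.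
         (\<lambda>n. a n - (\<eta> n + std_normal_quantile \<delta> / sqrt (real n)))
           \<in> o[sequentially](\<lambda>n. 1 / sqrt (real n)))) \<and>
     (\<eta> \<longlonglongrightarrow> 0 \<longrightarrow>
       (\<forall>a \<in> {aS, aH, aA}. \<forall>a' \<in> {aS, aH, aA}.
          asymp_equiv (\<lambda>n. 2 * a n) sequentially (\<lambda>n. 2 * a' n)) \<and>
       (\<forall>a \<in> {aS, aH, aA}.
          asymp_equiv (\<lambda>n. a n / standard_half_length n \<delta>) sequentially
            (\<lambda>n. sqrt (real n) * \<eta> n / std_normal_quantile ((1 + \<delta>) / 2)) \<and>
          filterlim (\<lambda>n. a n / standard_half_length n \<delta>) at_top sequentially))"
proof -
  let ?q = "std_normal_quantile \<delta>" and ?Q = "std_normal_quantile ((1 + \<delta>) / 2)"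
  note lim = shortest_half_length_limit[OF assms(1,2) _ assms(4)]
  have lims: "(\<lambda>n. sqrt (real n) * (a n - \<eta> n)) \<longlonglongrightarrow> ?q" if "a \<in> {aS, aH, aA}" for a
    using that lim[OF thresholding_soft[OF assms(3)]] lim[OF thresholding_hard[OF assms(3)]]
      lim[OF thresholding_adaptive[OF assms(3)]]
    by (auto simp: aS_def aH_def aA_def soft_threshold_def[abs_def] hard_threshold_def[abs_def]
        adaptive_lasso_def[abs_def])
  note equiv = asymp_equiv_of_scaled_limit[OF lims assms(4)]
  have Q: "?Q > 0"
    using assms(1,2) by (intro std_normal_quantile_pos) auto
  have ratio: "(\<lambda>n. a n / standard_half_length n \<delta>) \<sim>[sequentially] (\<lambda>n. sqrt (real n) * \<eta> n / ?Q)"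
    if a: "a \<in> {aS, aH, aA}" for a
  proof -
    have "(\<lambda>n. a n / (?Q / sqrt (real n))) \<sim>[sequentially] (\<lambda>n. \<eta> n / (?Q / sqrt (real n)))"
      by (intro asymp_equiv_intros equiv[OF a])
    then show ?thesis by (simp add: standard_half_length_def mult.commute)
  qed
  have diverge: "filterlim (\<lambda>n. a n / standard_half_length n \<delta>) at_top sequentially"
    if a: "a \<in> {aS, aH, aA}" for a
  proof -
    have "filterlim (\<lambda>n. sqrt (real n) * \<eta> n / ?Q) at_top sequentially"
      using filterlim_at_top_mult_tendsto_pos[OF tendsto_const[of "1 / ?Q"] _ assms(4)] Q
      by (simp add: mult.commute)
    then show ?thesis
      by (rule asymp_equiv_at_top_transfer[OF asymp_equiv_symI[OF ratio[OF a]]])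
  qed
  have "(\<lambda>n. 2 * a n) \<sim>[sequentially] (\<lambda>n. 2 * a' n)"
    if "a \<in> {aS, aH, aA}" "a' \<in> {aS, aH, aA}" for a a'
    by (intro asymp_equiv_intros asymp_equiv_trans[OF equiv[OF that(1)] asymp_equiv_symI[OF equiv[OF that(2)]]])
  with ratio diverge expansion_of_scaled_limit[OF lims] show ?thesis
    by (intro conjI ballI impI)
qed

end
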